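(* Consider the Pareto model with parameter set $\Theta=(1,\infty)$, and let $k>0$ and $\gamma\in[1,\infty]$ be fixed. Then for every $\beta\ge1$, the DR-Cramér–Lundberg failure probability $(\mathcal{E}^{k,\gamma}_{\mathcal{Q}|\mathbf{x}_N}\circ \mathrm{CL}_{\beta})(X)$ is regularizable.
   Context: Pareto model: $X, X_1,X_2,\dots$ are real random variables and $\mathcal{Q}=\{Q_\theta:\theta\in\Theta\}$ is the family of measures under which they are iid with density $f(x;\theta)=\theta x^{-(1+\theta)}$ for $x>1$. Here $\Theta=(1,\infty)$. Write $\mathbf{x}_N=(X_1,\dots,X_N)$, $\ell(\mathbf{x}_N;\theta)=\sum_{i=1}^N\log f(X_i;\theta)$, and define the divergence $\alpha_{\mathcal{Q}|\mathbf{x}_N}(\theta)=\sup_{\theta'\in\Theta}\ell(\mathbf{x}_N;\theta')-\ell(\mathbf{x}_N;\theta)$. For $\delta\in\mathbb{R}$, the $\delta$-truncation is $\alpha^{(\delta)}_{\mathcal{Q}|\mathbf{x}_N}(\theta)=\alpha_{\mathcal{Q}|\mathbf{x}_N}(\theta)$ if $\alpha_{\mathcal{Q}|\mathbf{x}_N}(\theta)\le N^\delta$ and $+\infty$ otherwise. For a risk assessment $\mathcal{R}$ (a map from laws on $\mathbb{R}$ to values in $(-\infty,\infty]$), write $\mathcal{R}_\theta$ for its value on the law of $X$ under $Q_\theta$. For $k>0$ and $\gamma\in[1,\infty]$, put $$(\mathcal{E}^{k,\gamma,\delta}_{\mathcal{Q}|\mathbf{x}_N}\circ\mathcal{R})(X)=\sup_{\theta\in\Theta}\Big\{\mathcal{R}_\theta-\Big(\tfrac1k\alpha^{(\delta)}_{\mathcal{Q}|\mathbf{x}_N}(\theta)\Big)^\gamma\Big\},$$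 where $|x|^\infty=0$ for $|x|\le1$ and $|x|^\infty=\infty$ otherwise, and parameters with infinite penalty are excluded from the supremum. This quantity is called regular (for given observations $\mathbf{x}_N$) if the supremum is finite and attained at a point $\theta$ with $\alpha_{\mathcal{Q}|\mathbf{x}_N}(\theta)<N^\delta$. The risk assessment $(\mathcal{E}^{k,\gamma}_{\mathcal{Q}|\mathbf{x}_N}\circ\mathcal{R})(X)$ is called regularizable if there exists $\delta>0$ such that, for every $P\in\mathcal{Q}$, with $P$-probability tending to $1$ as $N\to\infty$, $(\mathcal{E}^{k,\gamma,\delta}_{\mathcal{Q}|\mathbf{x}_N}\circ\mathcal{R})(X)$ is regular. The Cramér–Lundberg failure probability at level $\beta\ge1$ under $Q_\theta$ is $\mathrm{CL}_\beta(X)=\frac{E_{Q_\theta}[(X-\beta)^+]}{E_{Q_\theta}[X]}=\frac{\beta^{1-\theta}}{\theta}$. *)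

theory Defs
  imports "HOL-Probability.Probability"
begin

definition pareto_density :: "real \<Rightarrow> real \<Rightarrow> real" where
  "pareto_density \<theta> x = (if x > 1 then \<theta> * x powr - (1 + \<theta>) else 0)"

text \<open>
  All measures \<open>Q \<theta>\<close> live on the measurable space underlying \<open>M\<close>. The variable \<open>X 0\<close> is the
  generic variable whose risk is assessed; \<open>X 1\<close>, \<open>X 2\<close>, \<open>\<dots>\<close> are the observations.
\<close>

locale iid_model =
  fixes M :: "'a measure" and \<Theta> :: "real set" and f :: "real \<Rightarrow> real \<Rightarrow> real"
    and Q :: "real \<Rightarrow> 'a measure" and X :: "nat \<Rightarrow> 'a \<Rightarrow> real"
  assumes prob_space_Q: "\<theta> \<in> \<Theta> \<Longrightarrow> prob_space (Q \<theta>)"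
    and sets_Q: "\<theta> \<in> \<Theta> \<Longrightarrow> sets (Q \<theta>) = sets M"
    and indep_X: "\<theta> \<in> \<Theta> \<Longrightarrow> prob_space.indep_vars (Q \<theta>) (\<lambda>_. borel) X UNIV"
    and distributed_X:
      "\<theta> \<in> \<Theta> \<Longrightarrow> distributed (Q \<theta>) lborel (X i) (\<lambda>x. ennreal (f \<theta> x))"

text \<open>
  The logarithm of a vanishing density is \<open>-\<infinity>\<close> (HOL's \<open>ln 0\<close> is \<open>0\<close>).
\<close>

definition log_likelihood ::
  "(real \<Rightarrow> real \<Rightarrow> real) \<Rightarrow> nat \<Rightarrow> (nat \<Rightarrow> real) \<Rightarrow> real \<Rightarrow> ereal" where
  "log_likelihood f N x \<theta> =
     (\<Sum>i=1..N. if f \<theta> (x i) > 0 then ereal (ln (f \<theta> (x i))) else - \<infinity>)"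

text \<open>
  In \<^typ>\<open>ereal\<close>, \<open>-\<infinity> - (-\<infinity>) = \<infinity>\<close>, so a parameter of likelihood zero always has infinite
  divergence.
\<close>

definition divergence ::
  "real set \<Rightarrow> (real \<Rightarrow> real \<Rightarrow> real) \<Rightarrow> nat \<Rightarrow> (nat \<Rightarrow> real) \<Rightarrow> real \<Rightarrow> ereal" where
  "divergence \<Theta> f N x \<theta> =
     (SUP \<theta>'\<in>\<Theta>. log_likelihood f N x \<theta>') - log_likelihood f N x \<theta>"

definition truncated_divergence ::
  "real set \<Rightarrow> (real \<Rightarrow> real \<Rightarrow> real) \<Rightarrow> real \<Rightarrow> nat \<Rightarrow> (nat \<Rightarrow> real) \<Rightarrow> real \<Rightarrow> ereal" where
  "truncated_divergence \<Theta> f \<delta> N x \<theta> =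
     (if divergence \<Theta> f N x \<theta> \<le> ereal (real N powr \<delta>) then divergence \<Theta> f N x \<theta> else \<infinity>)"

definition abs_pow :: "ereal \<Rightarrow> ereal \<Rightarrow> ereal" where
  "abs_pow y \<gamma> =
     (if \<gamma> = \<infinity> then (if \<bar>y\<bar> \<le> 1 then 0 else \<infinity>)
      else if \<bar>y\<bar> = \<infinity> then \<infinity>
      else ereal (\<bar>real_of_ereal y\<bar> powr real_of_ereal \<gamma>))"

definition DR_penalty ::
  "real set \<Rightarrow> (real \<Rightarrow> real \<Rightarrow> real) \<Rightarrow> real \<Rightarrow> ereal \<Rightarrow> real \<Rightarrow> nat \<Rightarrow> (nat \<Rightarrow> real) \<Rightarrow> real \<Rightarrow> ereal"
where
  "DR_penalty \<Theta> f k \<gamma> \<delta> N x \<theta> =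
     abs_pow (ereal (1 / k) * truncated_divergence \<Theta> f \<delta> N x \<theta>) \<gamma>"

definition DR_feasible ::
  "real set \<Rightarrow> (real \<Rightarrow> real \<Rightarrow> real) \<Rightarrow> real \<Rightarrow> ereal \<Rightarrow> real \<Rightarrow> nat \<Rightarrow> (nat \<Rightarrow> real) \<Rightarrow> real set"
where
  "DR_feasible \<Theta> f k \<gamma> \<delta> N x = {\<theta> \<in> \<Theta>. DR_penalty \<Theta> f k \<gamma> \<delta> N x \<theta> < \<infinity>}"

text \<open>Below, \<open>r \<theta>\<close> is the value of the risk assessment on the law of the generic variable
  under \<open>Q \<theta>\<close>.\<close>

definition DR_value ::
  "real set \<Rightarrow> (real \<Rightarrow> real \<Rightarrow> real) \<Rightarrow> (real \<Rightarrow> ereal) \<Rightarrow> real \<Rightarrow> ereal \<Rightarrow> real \<Rightarrow> nat \<Rightarrow>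
     (nat \<Rightarrow> real) \<Rightarrow> ereal"
where
  "DR_value \<Theta> f r k \<gamma> \<delta> N x =
     (SUP \<theta>\<in>DR_feasible \<Theta> f k \<gamma> \<delta> N x. r \<theta> - DR_penalty \<Theta> f k \<gamma> \<delta> N x \<theta>)"

definition DR_regular ::
  "real set \<Rightarrow> (real \<Rightarrow> real \<Rightarrow> real) \<Rightarrow> (real \<Rightarrow> ereal) \<Rightarrow> real \<Rightarrow> ereal \<Rightarrow> real \<Rightarrow> nat \<Rightarrow>
     (nat \<Rightarrow> real) \<Rightarrow> bool"
where
  "DR_regular \<Theta> f r k \<gamma> \<delta> N x \<longleftrightarrow>
     \<bar>DR_value \<Theta> f r k \<gamma> \<delta> N x\<bar> \<noteq> \<infinity> \<and>
     (\<exists>\<theta>\<in>DR_feasible \<Theta> f k \<gamma> \<delta> N x.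
        r \<theta> - DR_penalty \<Theta> f k \<gamma> \<delta> N x \<theta> = DR_value \<Theta> f r k \<gamma> \<delta> N x \<and>
        divergence \<Theta> f N x \<theta> < ereal (real N powr \<delta>))"

text \<open>
  Regularity of a general risk assessment need not be a measurable event, so ``with probability
  tending to one'' is expressed by measurable events contained in it. For measurable events
  this is the usual notion.
\<close>

definition with_prob_tending_to_1 :: "'a measure \<Rightarrow> (nat \<Rightarrow> 'a \<Rightarrow> bool) \<Rightarrow> bool" where
  "with_prob_tending_to_1 P E \<longleftrightarrow>
     (\<exists>A. (\<forall>N. A N \<in> sets P \<and> (\<forall>\<omega>\<in>A N. E N \<omega>)) \<and> (\<lambda>N. measure P (A N)) \<longlonglongrightarrow> 1)"

definition DR_regularizable ::
  "real set \<Rightarrow> (real \<Rightarrow> real \<Rightarrow> real) \<Rightarrow> (real \<Rightarrow> 'a measure) \<Rightarrow> (nat \<Rightarrow> 'a \<Rightarrow> real) \<Rightarrow>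
     (real measure \<Rightarrow> ereal) \<Rightarrow> real \<Rightarrow> ereal \<Rightarrow> bool"
where
  "DR_regularizable \<Theta> f Q X R k \<gamma> \<longleftrightarrow>
     (\<exists>\<delta>>0. \<forall>P\<in>Q ` \<Theta>. with_prob_tending_to_1 P
        (\<lambda>N \<omega>. DR_regular \<Theta> f (\<lambda>\<theta>. R (distr (Q \<theta>) borel (X 0))) k \<gamma> \<delta> N (\<lambda>i. X i \<omega>)))"

text \<open>
  The Cramer-Lundberg failure probability of a law with finite nonzero mean; the Bochner integral
  of a non-integrable function is \<open>0\<close>, so other laws yield a junk value.
\<close>

definition CL :: "real \<Rightarrow> real measure \<Rightarrow> ereal" where
  "CL \<beta> L = ereal ((LINT x|L. max (x - \<beta>) 0) / (LINT x|L. x))"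

end

(* With t the average of the ln X_i, the MLE is 1/t and the divergence at \<theta> is
   N (\<theta> t - 1 - ln (\<theta> t)). Take \<delta> = 1/2. The ln X_i are exponential with mean 1/\<theta>0 < 1 under the
   true parameter \<theta>0, so by Chebyshev t stays below some c < 1 with probability tending to 1.
   Then the divergence at the excluded endpoint 1 of the parameter set grows linearly in N, so the
   set K of parameters with divergence at most k is compact once N is large. Outside K the
   penalty is at least 1 while CL lies in (0, 1], so the supremum is attained on K, where the
   divergence is at most k < N^(1/2). *)

theory Submission imports Defs "HOL-Real_Asymp.Real_Asymp" begin

section \<open>Integrals of the Pareto density and the Cramer-Lundberg value\<close>

lemma pareto_density_measurable [measurable]: "pareto_density \<theta> \<in> borel_measurable borel"
  unfolding pareto_density_def by measurable

lemma pareto_density_nonneg: "\<theta> \<ge> 0 \<Longrightarrow> 0 \<le> pareto_density \<theta> x"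
  by (auto simp: pareto_density_def)

lemma nn_integral_pareto_tail:
  assumes "\<theta> > 0" "a \<ge> 1"
  shows "(\<integral>\<^sup>+x. ennreal (pareto_density \<theta> x) * indicator {a<..} x \<partial>lborel) = ennreal (a powr - \<theta>)"
proof -
  have "(\<integral>\<^sup>+x. ennreal (pareto_density \<theta> x) * indicator {a<..} x \<partial>lborel)
      = (\<integral>\<^sup>+x. ennreal (\<theta> * x powr - (1 + \<theta>)) * indicator {a..} x \<partial>lborel)"
    \<comment> \<open>The integrands may differ at \<open>a\<close> itself, a null point. Closing
      the half-line there brings the integral into the form of the fundamental theorem.\<close>
    using AE_lborel_singleton[of a] assms
    by (intro nn_integral_cong_AE)
      (auto elim!: eventually_mono simp: pareto_density_def split: split_indicator)
  also have "\<dots> = ennreal (0 - - (a powr - \<theta>))"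
  proof (rule nn_integral_FTC_atLeast)
    fix x assume "a \<le> x"
    then have "((\<lambda>x. - (x powr - \<theta>)) has_real_derivative - (- \<theta> * x powr (- \<theta> - 1))) (at x)"
      using assms by (intro derivative_intros has_real_derivative_powr) auto
    moreover have "- \<theta> - 1 = - (1 + \<theta>)" by simp
    ultimately show "((\<lambda>x. - (x powr - \<theta>)) has_real_derivative \<theta> * x powr - (1 + \<theta>)) (at x)"
      by (simp only: minus_mult_left minus_minus)
  next
    show "((\<lambda>x. - (x powr - \<theta>)) \<longlongrightarrow> 0) at_top"
      using tendsto_minus[OF tendsto_neg_powr[OF _ filterlim_ident, of "- \<theta>"]] assms by simp
  qed (use assms in auto)
  finally show ?thesis by simp
qed

text \<open>The lower limit is \<open>max 1 b\<close> because the density vanishes up to 1 and the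
  positive part up to \<open>b\<close>. Admitting every \<open>b \<ge> 0\<close> lets one
  computation serve both the mean (\<open>b = 0\<close>) and the expected excess over
  \<open>\<beta>\<close>.\<close>

lemma nn_integral_pareto_excess:
  assumes "\<theta> > 1" "b \<ge> 0"
  defines "a \<equiv> max 1 b"
  shows "(\<integral>\<^sup>+x. ennreal (pareto_density \<theta> x * max (x - b) 0) \<partial>lborel)
       = ennreal (\<theta> * a powr (1 - \<theta>) / (\<theta> - 1) - b * a powr - \<theta>)"
proof -
  have a: "a \<ge> 1" "a \<ge> b" by (auto simp: a_def)
  have "(\<integral>\<^sup>+x. ennreal (pareto_density \<theta> x * max (x - b) 0) \<partial>lborel)
      = (\<integral>\<^sup>+x. ennreal (\<theta> * x powr - (1 + \<theta>) * (x - b)) * indicator {a..} x \<partial>lborel)"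
    using AE_lborel_singleton[of a] assms
    by (intro nn_integral_cong_AE)
      (auto elim!: eventually_mono simp: pareto_density_def max_def split: split_indicator if_splits)
  also have "\<dots> = ennreal (0 - (\<theta> * a powr (1 - \<theta>) / (1 - \<theta>) + b * a powr - \<theta>))"
  proof (rule nn_integral_FTC_atLeast)
    fix x assume "a \<le> x"
    then have x: "x > 0" using a by auto
    have 1: "x * x powr (- 1 - \<theta>) = x powr - \<theta>"
      using powr_add[of x 1 "-1-\<theta>"] x by simp
    have "((\<lambda>x. \<theta> * x powr (1 - \<theta>) / (1 - \<theta>) + b * x powr - \<theta>) has_real_derivative
        \<theta> * ((1 - \<theta>) * x powr (1 - \<theta> - 1)) / (1 - \<theta>) + b * (- \<theta> * x powr (- \<theta> - 1))) (at x)"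
      using x by (intro DERIV_add DERIV_cdivide DERIV_cmult has_real_derivative_powr)
    also have "\<theta> * ((1 - \<theta>) * x powr (1 - \<theta> - 1)) / (1 - \<theta>) + b * (- \<theta> * x powr (- \<theta> - 1))
        = \<theta> * x powr - \<theta> - b * \<theta> * x powr (- \<theta> - 1)"
      using assms(1) by (simp add: mult.assoc)
    also have "- \<theta> - 1 = - 1 - \<theta>" by simp
    also have "\<theta> * x powr - \<theta> - b * \<theta> * x powr (- 1 - \<theta>) = \<theta> * x powr - (1 + \<theta>) * (x - b)"
      by (simp add: algebra_simps 1[symmetric])
    finally show "((\<lambda>x. \<theta> * x powr (1 - \<theta>) / (1 - \<theta>) + b * x powr - \<theta>) has_real_derivative
        \<theta> * x powr - (1 + \<theta>) * (x - b)) (at x)" .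
  next
    have *: "((\<lambda>x::real. x powr s) \<longlongrightarrow> 0) at_top" if "s < 0" for s
      using tendsto_neg_powr[OF that filterlim_ident] .
    have "((\<lambda>x. \<theta> * x powr (1 - \<theta>) / (1 - \<theta>) + b * x powr - \<theta>)
        \<longlongrightarrow> \<theta> * 0 / (1 - \<theta>) + b * 0) at_top"
      by (intro tendsto_intros *) (use assms in auto)
    then show "((\<lambda>x. \<theta> * x powr (1 - \<theta>) / (1 - \<theta>) + b * x powr - \<theta>) \<longlongrightarrow> 0) at_top"
      by simp
  qed (use assms a in auto)
  also have "0 - (\<theta> * a powr (1 - \<theta>) / (1 - \<theta>) + b * a powr - \<theta>)
      = \<theta> * a powr (1 - \<theta>) / (\<theta> - 1) - b * a powr - \<theta>"
    using assms(1) by (simp add: divide_simps) (simp add: algebra_simps)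
  finally show ?thesis .
qed

lemma integral_pareto_excess:
  assumes "\<theta> > 1" "b \<ge> 0"
  defines "a \<equiv> max 1 b"
  shows "(\<integral>x. pareto_density \<theta> x * max (x - b) 0 \<partial>lborel)
       = \<theta> * a powr (1 - \<theta>) / (\<theta> - 1) - b * a powr - \<theta>"
proof -
  have a: "a \<ge> 1" "a \<ge> b" by (auto simp: a_def)
  \<comment> \<open>\<open>ennreal\<close> sends negative numbers to 0, so the real value can be
    read off the nonnegative integral only once the closed form is known to be nonnegative.\<close>
  have "b * a powr - \<theta> \<le> a * a powr - \<theta>"
    using a by (intro mult_right_mono) auto
  also have "\<dots> = a powr (1 - \<theta>)"
    using a powr_add[of a 1 "- \<theta>"] by simp
  also have "\<dots> \<le> \<theta> * a powr (1 - \<theta>) / (\<theta> - 1)"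
    using assms(1) by (simp add: field_simps)
  finally have "0 \<le> \<theta> * a powr (1 - \<theta>) / (\<theta> - 1) - b * a powr - \<theta>"
    by simp
  then show ?thesis
    using nn_integral_pareto_excess[OF assms(1,2)] assms(1) pareto_density_nonneg[of \<theta>]
    by (subst integral_eq_nn_integral) (auto simp: a_def)
qed

text \<open>Numerator and denominator are the excess integrals at \<open>b = \<beta>\<close> and
  \<open>b = 0\<close>; their common factor \<open>1 / (\<theta> - 1)\<close> cancels.\<close>

lemma CL_pareto:
  assumes X: "distributed M lborel X (\<lambda>x. ennreal (pareto_density \<theta> x))"
    and "\<theta> > 1" "\<beta> \<ge> 1"
  shows "CL \<beta> (distr M borel X) = ereal (\<beta> powr (1 - \<theta>) / \<theta>)"
proof -
  have [measurable]: "X \<in> borel_measurable M"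
    using distributed_measurable[OF X] by simp
  have nonneg: "0 \<le> pareto_density \<theta> x" for x
    using pareto_density_nonneg[of \<theta> x] assms(2) by simp
  have "(LINT x|distr M borel X. max (x - \<beta>) 0) = (\<integral>\<omega>. max (X \<omega> - \<beta>) 0 \<partial>M)"
    by (rule integral_distr) auto
  also have "\<dots> = (\<integral>x. pareto_density \<theta> x * max (x - \<beta>) 0 \<partial>lborel)"
    using nonneg by (intro distributed_integral[OF X, symmetric]) auto
  also have "\<dots> = \<theta> * \<beta> powr (1 - \<theta>) / (\<theta> - 1) - \<beta> * \<beta> powr - \<theta>"
    using assms by (subst integral_pareto_excess) (auto simp: max_def)
  also have "\<beta> * \<beta> powr - \<theta> = \<beta> powr (1 - \<theta>)"
    using assms powr_add[of \<beta> 1 "- \<theta>"] by simp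
  also have "\<theta> * \<beta> powr (1 - \<theta>) / (\<theta> - 1) - \<beta> powr (1 - \<theta>) = \<beta> powr (1 - \<theta>) / (\<theta> - 1)"
    using assms by (simp add: field_simps)
  finally have 1: "(LINT x|distr M borel X. max (x - \<beta>) 0) = \<beta> powr (1 - \<theta>) / (\<theta> - 1)" .
  have "(LINT x|distr M borel X. x) = (\<integral>\<omega>. X \<omega> \<partial>M)"
    by (rule integral_distr) auto
  also have "\<dots> = (\<integral>x. pareto_density \<theta> x * x \<partial>lborel)"
    using nonneg by (intro distributed_integral[OF X, symmetric]) auto
  also have "\<dots> = (\<integral>x. pareto_density \<theta> x * max (x - 0) 0 \<partial>lborel)"
    by (intro Bochner_Integration.integral_cong) (auto simp: pareto_density_def)
  also have "\<dots> = \<theta> / (\<theta> - 1)"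
    using assms by (subst integral_pareto_excess) auto
  finally show ?thesis
    using 1 assms by (simp add: CL_def)
qed

section \<open>The exponential law of the log-observations and concentration of their sum\<close>

lemma (in prob_space) pareto_tail:
  assumes X: "distributed M lborel X (\<lambda>x. ennreal (pareto_density \<theta> x))"
    and "\<theta> > 0" "a \<ge> 1"
  shows "\<P>(\<omega> in M. X \<omega> > a) = a powr - \<theta>"
proof -
  have "emeasure M (X -` {a<..} \<inter> space M) = ennreal (a powr - \<theta>)"
    using distributed_emeasure[OF X, of "{a<..}"] nn_integral_pareto_tail[OF assms(2,3)] by simp
  also have "X -` {a<..} \<inter> space M = {\<omega>\<in>space M. X \<omega> > a}"
    by auto
  finally show ?thesis
    by (simp add: emeasure_eq_measure)
qed

lemma (in prob_space) pareto_AE_gt_1: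
  assumes X: "distributed M lborel X (\<lambda>x. ennreal (pareto_density \<theta> x))" and "\<theta> > 0"
  shows "AE \<omega> in M. X \<omega> > 1"
proof -
  have [measurable]: "X \<in> borel_measurable M"
    using distributed_measurable[OF X] by simp
  show ?thesis
    using pareto_tail[OF assms, of 1] by (simp add: prob_Collect_eq_1)
qed

lemma (in prob_space) ln_pareto_exponential:
  assumes X: "distributed M lborel X (\<lambda>x. ennreal (pareto_density \<theta> x))" and "\<theta> > 0"
  shows "distributed M lborel (\<lambda>\<omega>. ln (X \<omega>)) (exponential_density \<theta>)"
proof (subst exponential_distributed_iff[OF \<open>\<theta> > 0\<close>], intro conjI allI impI)
  have [measurable]: "X \<in> borel_measurable M"
    using distributed_measurable[OF X] by simp
  then show "(\<lambda>\<omega>. ln (X \<omega>)) \<in> borel_measurable M" by measurable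
  fix a :: real assume "0 \<le> a"
  \<comment> \<open>The two events are compared only almost everywhere: turning
    \<open>ln (X \<omega>) \<le> a\<close> into \<open>X \<omega> \<le> exp a\<close> uses that
    \<open>X\<close> is positive.\<close>
  have "prob {\<omega> \<in> space M. ln (X \<omega>) \<le> a} = prob {\<omega> \<in> space M. \<not> X \<omega> > exp a}"
    using pareto_AE_gt_1[OF assms]
    by (intro measure_eq_AE)
      (auto elim!: eventually_mono simp: not_less ln_le_cancel_iff[symmetric] simp del: ln_le_cancel_iff)
  also have "\<dots> = 1 - exp a powr - \<theta>"
    using pareto_tail[OF assms, of "exp a"] \<open>0 \<le> a\<close> by (subst prob_neg) auto
  finally show "prob {\<omega> \<in> space M. ln (X \<omega>) \<le> a} = 1 - exp (- a * \<theta>)"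
    by (simp add: powr_def mult.commute)
qed

text \<open>A sum of \<open>N\<close> independent exponentials is Erlang with mean
  \<open>N / \<theta>\<close> and variance \<open>N / \<theta>^2\<close>, so Chebyshev's inequality
  applies.\<close>

lemma (in prob_space) pareto_ln_sum_deviation:
  assumes X: "\<And>i. distributed M lborel (X i) (\<lambda>x. ennreal (pareto_density \<theta> x))"
    and ind: "indep_vars (\<lambda>_. borel) X UNIV"
    and "\<theta> > 0" "\<epsilon> > 0" "N > 0"
  shows "\<P>(\<omega> in M. (\<Sum>i=1..N. ln (X i \<omega>)) > real N * (1 / \<theta> + \<epsilon>)) \<le> 1 / (\<theta>\<^sup>2 * \<epsilon>\<^sup>2 * real N)"
proof -
  define S where "S \<omega> = (\<Sum>i=1..N. ln (X i \<omega>))" for \<omega>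
  have "indep_vars (\<lambda>_. borel) (\<lambda>i \<omega>. ln (X i \<omega>)) UNIV"
    by (rule indep_vars_compose2[OF ind]) auto
  then have "indep_vars (\<lambda>_. borel) (\<lambda>i \<omega>. ln (X i \<omega>)) {1..N}"
    by (rule indep_vars_subset) auto
  \<comment> \<open>The shape index of \<open>erlang_density\<close> starts at 0 for a single
    exponential, hence \<open>N - 1\<close> for \<open>N\<close> summands.\<close>
  then have S: "distributed M lborel S (erlang_density (N - 1) \<theta>)"
    using exponential_distributed_sum[of "{1..N}" \<theta> "\<lambda>i \<omega>. ln (X i \<omega>)"]
      ln_pareto_exponential[OF X] assms unfolding S_def by auto
  have [measurable]: "S \<in> borel_measurable M"
    using distributed_measurable[OF S] by simp
  have mean: "expectation S = real N / \<theta>"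
    using erlang_ith_moment[OF \<open>\<theta> > 0\<close> S, of 1] \<open>N > 0\<close> fact_reduce[of N, where 'a = real] by simp
  have var: "variance S = real N / \<theta>\<^sup>2"
    using erlang_distributed_variance[OF \<open>\<theta> > 0\<close> S] \<open>N > 0\<close> by (simp add: of_nat_diff)
  have "\<P>(\<omega> in M. S \<omega> > real N * (1 / \<theta> + \<epsilon>)) \<le> \<P>(\<omega> in M. \<bar>S \<omega> - expectation S\<bar> \<ge> real N * \<epsilon>)"
    unfolding mean by (intro finite_measure_mono) (auto simp: algebra_simps)
  also have "\<dots> \<le> variance S / (real N * \<epsilon>)\<^sup>2"
    using erlang_ith_moment_integrable[OF \<open>\<theta> > 0\<close> S, of 2] assms
    by (intro Chebyshev_inequality) auto
  also have "\<dots> = 1 / (\<theta>\<^sup>2 * \<epsilon>\<^sup>2 * real N)"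
    unfolding var using assms by (simp add: power2_eq_square field_simps)
  finally show ?thesis unfolding S_def .
qed

section \<open>Closed forms of the likelihood and the divergence\<close>

text \<open>Observations above 1 keep every summand out of the \<open>- \<infinity>\<close> branch,
  and the data then enter only through the sum of their logarithms.\<close>

lemma log_likelihood_pareto:
  assumes "\<And>i. i \<in> {1..N} \<Longrightarrow> x i > 1" "\<theta> > 0"
  shows "log_likelihood pareto_density N x \<theta>
    = ereal (real N * ln \<theta> - (1 + \<theta>) * (\<Sum>i=1..N. ln (x i)))"
proof -
  have "log_likelihood pareto_density N x \<theta> = (\<Sum>i=1..N. ereal (ln \<theta> - (1 + \<theta>) * ln (x i)))"
    unfolding log_likelihood_def
  proof (rule sum.cong[OF refl])
    fix i assume "i \<in> {1..N}"
    then have "x i > 1" using assms by blast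
    then show "(if pareto_density \<theta> (x i) > 0 then ereal (ln (pareto_density \<theta> (x i))) else - \<infinity>)
        = ereal (ln \<theta> - (1 + \<theta>) * ln (x i))"
      using assms(2) by (simp add: pareto_density_def ln_mult ln_powr algebra_simps)
  qed
  then show ?thesis
    by (simp add: sum_subtractf sum_distrib_left)
qed

text \<open>Per observation the log-likelihood is \<open>ln (\<theta> * t) - \<theta> * t\<close>
  plus terms free of \<open>\<theta>\<close>. The bound \<open>ln u \<le> u - 1\<close> caps it,
  with equality at \<open>\<theta> = 1 / t\<close>, which belongs to the parameter set because
  \<open>t < 1\<close>.\<close>

lemma divergence_pareto:
  assumes x: "\<And>i. i \<in> {1..N} \<Longrightarrow> x i > 1" and "N > 0"
  defines "t \<equiv> (\<Sum>i=1..N. ln (x i)) / real N"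
  assumes "t < 1" "\<theta> > 1"
  shows "divergence {1<..} pareto_density N x \<theta> = ereal (real N * (\<theta> * t - 1 - ln (\<theta> * t)))"
proof -
  have "(\<Sum>i=1..N. ln (x i)) > 0"
    using x \<open>N > 0\<close> by (intro sum_pos) (auto intro!: ln_gt_zero)
  then have t: "t > 0" and S: "(\<Sum>i=1..N. ln (x i)) = real N * t"
    using \<open>N > 0\<close> by (auto simp: t_def)
  have ll: "log_likelihood pareto_density N x \<theta> = ereal (real N * (ln \<theta> - (1 + \<theta>) * t))"
    if "\<theta> > 1" for \<theta>
    using that log_likelihood_pareto[of N x \<theta>] x unfolding S by (simp add: algebra_simps)
  have "(SUP \<theta>\<in>{1<..}. log_likelihood pareto_density N x \<theta>) = ereal (real N * (- ln t - t - 1))"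
  proof (rule SUP_eqI)
    fix \<theta> :: real assume "\<theta> \<in> {1<..}"
    then have "ln (\<theta> * t) \<le> \<theta> * t - 1"
      using t by (intro ln_le_minus_one) auto
    then have "ln \<theta> - (1 + \<theta>) * t \<le> - ln t - t - 1"
      using t \<open>\<theta> \<in> _\<close> by (simp add: ln_mult algebra_simps)
    then show "log_likelihood pareto_density N x \<theta> \<le> ereal (real N * (- ln t - t - 1))"
      using ll[of \<theta>] \<open>\<theta> \<in> _\<close> by (auto intro!: mult_left_mono)
  next
    fix y assume y: "\<And>\<theta>. \<theta> \<in> {1<..} \<Longrightarrow> log_likelihood pareto_density N x \<theta> \<le> y"
    have "1 / t > 1" using t \<open>t < 1\<close> by simp
    then show "ereal (real N * (- ln t - t - 1)) \<le> y"
      using y[of "1 / t"] ll[of "1 / t"] t by (simp add: ln_div algebra_simps)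
  qed
  then show ?thesis
    unfolding divergence_def using ll[OF \<open>\<theta> > 1\<close>] t \<open>\<theta> > 1\<close>
    by (simp add: ln_mult algebra_simps)
qed

text \<open>Serves to bound the divergence at the endpoint 1 from below when only an upper bound
  \<open>c\<close> on \<open>t\<close> is known. The tangent bound for \<open>ln\<close> at
  \<open>t / c\<close> replaces a derivative argument.\<close>

lemma minus_ln_antimono:
  fixes t c :: real
  assumes "0 < t" "t \<le> c" "c \<le> 1"
  shows "c - ln c \<le> t - ln t"
proof -
  have "ln (t / c) \<le> t / c - 1" using assms by (intro ln_le_minus_one) auto
  then have "(c - t) / c \<le> ln c - ln t" using assms by (simp add: ln_div diff_divide_distrib)
  moreover have "c - t \<le> (c - t) / c"
    using assms mult_left_mono[of c 1 "c - t"] by (simp add: field_simps)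
  ultimately show ?thesis by simp
qed

section \<open>Regularity for a fixed sample\<close>

lemma abs_pow_ereal:
  "abs_pow (ereal y) \<gamma> = (if \<gamma> = \<infinity> then (if \<bar>y\<bar> \<le> 1 then 0 else \<infinity>)
     else ereal (\<bar>y\<bar> powr real_of_ereal \<gamma>))"
  by (simp add: abs_pow_def one_ereal_def)

text \<open>The compactness argument, separated from the Pareto model. The zero-divergence point
  \<open>\<theta>'\<close> makes \<open>K\<close> nonempty and the maximum over \<open>K\<close>
  positive, whereas outside \<open>K\<close> the objective is at most \<open>1 - 1\<close>. Since
  \<open>k < N powr \<delta>\<close>, truncation does not act on \<open>K\<close>.\<close>

lemma DR_regularI:
  fixes r :: "real \<Rightarrow> ereal" and \<rho> d :: "real \<Rightarrow> real" and K :: "real set"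
  assumes "k > 0" "1 \<le> \<gamma>" and kN: "k < real N powr \<delta>"
    and r: "\<And>\<theta>. \<theta> \<in> \<Theta> \<Longrightarrow> r \<theta> = ereal (\<rho> \<theta>)"
    and \<rho>: "\<And>\<theta>. \<theta> \<in> \<Theta> \<Longrightarrow> 0 < \<rho> \<theta>" "\<And>\<theta>. \<theta> \<in> \<Theta> \<Longrightarrow> \<rho> \<theta> \<le> 1"
    and d: "\<And>\<theta>. \<theta> \<in> \<Theta> \<Longrightarrow> divergence \<Theta> f N x \<theta> = ereal (d \<theta>)"
    and d0: "\<And>\<theta>. \<theta> \<in> \<Theta> \<Longrightarrow> 0 \<le> d \<theta>"
    and K: "K = {\<theta>\<in>\<Theta>. d \<theta> \<le> k}" "compact K"
    and cont: "continuous_on K \<rho>" "continuous_on K d"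
    and mle: "\<theta>' \<in> \<Theta>" "d \<theta>' = 0"
  shows "DR_regular \<Theta> f r k \<gamma> \<delta> N x"
proof -
  \<comment> \<open>The penalty on \<open>K\<close>: for \<open>\<gamma> = \<infinity>\<close> it
    vanishes there because \<open>d \<theta> / k \<le> 1\<close>.\<close>
  define p where "p \<theta> = (if \<gamma> = \<infinity> then 0 else (d \<theta> / k) powr real_of_ereal \<gamma>)" for \<theta>
  have \<gamma>: "real_of_ereal \<gamma> \<ge> 1" if "\<gamma> \<noteq> \<infinity>"
    using that \<open>1 \<le> \<gamma>\<close> by (cases \<gamma>) (auto simp: one_ereal_def)
  have pen: "DR_penalty \<Theta> f k \<gamma> \<delta> N x \<theta> = ereal (p \<theta>)" if "\<theta> \<in> K" for \<theta>
  proof -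
    have \<theta>: "\<theta> \<in> \<Theta>" "d \<theta> \<le> k" using that K by auto
    then show ?thesis
      using kN d[OF \<theta>(1)] d0[OF \<theta>(1)] \<open>k > 0\<close>
      by (simp add: DR_penalty_def truncated_divergence_def abs_pow_ereal p_def)
  qed
  have pen_large: "1 \<le> DR_penalty \<Theta> f k \<gamma> \<delta> N x \<theta>" if \<theta>: "\<theta> \<in> \<Theta>" "d \<theta> > k" for \<theta>
  proof (cases "d \<theta> \<le> real N powr \<delta>")
    case True
    have "1 \<le> d \<theta> / k" using that \<open>k > 0\<close> by simp
    then have "1 \<le> (d \<theta> / k) powr real_of_ereal \<gamma>" if "\<gamma> \<noteq> \<infinity>"
      using \<gamma>[OF that] by (intro ge_one_powr_ge_zero) auto
    then show ?thesis
      using True d[OF \<theta>(1)] d0[OF \<theta>(1)] \<theta> \<open>k > 0\<close>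
      by (simp add: DR_penalty_def truncated_divergence_def abs_pow_ereal one_ereal_def)
  next
    case False
    then show ?thesis
      using d[OF \<theta>(1)] \<open>k > 0\<close>
      by (simp add: DR_penalty_def truncated_divergence_def abs_pow_def one_ereal_def)
  qed
  have "\<theta>' \<in> K" using mle K \<open>k > 0\<close> by simp
  \<comment> \<open>The base vanishes at \<open>\<theta>'\<close>; continuity of \<open>powr\<close>
    at base 0 requires a positive exponent, which \<open>1 \<le> \<gamma>\<close> supplies.\<close>
  have "continuous_on K (\<lambda>\<theta>. (d \<theta> / k) powr real_of_ereal \<gamma>)" if "\<gamma> \<noteq> \<infinity>"
    by (rule continuous_on_powr') (use \<gamma>[OF that] cont K d0 \<open>k > 0\<close> in \<open>auto intro!: continuous_intros\<close>)
  then have "continuous_on K p"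
    unfolding p_def by (cases "\<gamma> = \<infinity>") auto
  then have "continuous_on K (\<lambda>\<theta>. \<rho> \<theta> - p \<theta>)"
    by (intro continuous_intros cont)
  then obtain \<tau> where \<tau>: "\<tau> \<in> K" "\<And>\<theta>. \<theta> \<in> K \<Longrightarrow> \<rho> \<theta> - p \<theta> \<le> \<rho> \<tau> - p \<tau>"
    using continuous_attains_sup[of K "\<lambda>\<theta>. \<rho> \<theta> - p \<theta>"] \<open>compact K\<close> \<open>\<theta>' \<in> K\<close> by auto
  have "p \<theta>' = 0" using mle by (simp add: p_def)
  then have pos: "0 < \<rho> \<tau> - p \<tau>"
    using \<tau>(2)[OF \<open>\<theta>' \<in> K\<close>] \<rho>(1)[OF mle(1)] by simp
  have \<tau>_feasible: "\<tau> \<in> DR_feasible \<Theta> f k \<gamma> \<delta> N x"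
    using pen[OF \<tau>(1)] \<tau>(1) K by (simp add: DR_feasible_def)
  have r\<tau>: "r \<tau> - DR_penalty \<Theta> f k \<gamma> \<delta> N x \<tau> = ereal (\<rho> \<tau> - p \<tau>)"
    using pen[OF \<tau>(1)] r[of \<tau>] \<tau>(1) K by simp
  have val: "DR_value \<Theta> f r k \<gamma> \<delta> N x = ereal (\<rho> \<tau> - p \<tau>)"
    unfolding DR_value_def
  proof (rule SUP_eqI)
    fix \<theta> assume "\<theta> \<in> DR_feasible \<Theta> f k \<gamma> \<delta> N x"
    then have \<theta>: "\<theta> \<in> \<Theta>" by (simp add: DR_feasible_def)
    show "r \<theta> - DR_penalty \<Theta> f k \<gamma> \<delta> N x \<theta> \<le> ereal (\<rho> \<tau> - p \<tau>)"
    proof (cases "\<theta> \<in> K")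
      case True
      then show ?thesis using \<tau>(2)[OF True] pen[OF True] r[OF \<theta>] by simp
    next
      case False
      then have "d \<theta> > k" using \<theta> K by simp
      have "r \<theta> \<le> 1" using r[OF \<theta>] \<rho>(2)[OF \<theta>] by (simp add: one_ereal_def)
      then have "r \<theta> - DR_penalty \<Theta> f k \<gamma> \<delta> N x \<theta> \<le> 1 - 1"
        using pen_large[OF \<theta> \<open>d \<theta> > k\<close>] by (rule ereal_minus_mono)
      also have "\<dots> \<le> ereal (\<rho> \<tau> - p \<tau>)"
        using pos by (simp add: one_ereal_def zero_ereal_def)
      finally show ?thesis .
    qed
  next
    fix y assume "\<And>\<theta>. \<theta> \<in> DR_feasible \<Theta> f k \<gamma> \<delta> N x \<Longrightarrow>
      r \<theta> - DR_penalty \<Theta> f k \<gamma> \<delta> N x \<theta> \<le> y"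
    from this[OF \<tau>_feasible] show "ereal (\<rho> \<tau> - p \<tau>) \<le> y"
      unfolding r\<tau> .
  qed
  have "divergence \<Theta> f N x \<tau> < ereal (real N powr \<delta>)"
    using d[of \<tau>] \<tau>(1) K kN by simp
  then show ?thesis
    unfolding DR_regular_def using val r\<tau> \<tau>_feasible by auto
qed

text \<open>Compactness of the sublevel set has two sources: \<open>kc\<close> pushes the divergence
  at the endpoint 1 above \<open>k\<close>, and the linear term of the divergence outgrows its
  logarithm for large parameters.\<close>

lemma DR_regular_pareto:
  fixes r :: "real \<Rightarrow> ereal" and \<rho> :: "real \<Rightarrow> real"
  assumes "k > 0" "1 \<le> \<gamma>" and kN: "k < real N powr \<delta>"
    and r: "\<And>\<theta>. \<theta> > 1 \<Longrightarrow> r \<theta> = ereal (\<rho> \<theta>)"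
    and \<rho>: "\<And>\<theta>. \<theta> > 1 \<Longrightarrow> 0 < \<rho> \<theta>" "\<And>\<theta>. \<theta> > 1 \<Longrightarrow> \<rho> \<theta> \<le> 1" "continuous_on {1<..} \<rho>"
    and x: "\<And>i. i \<in> {1..N} \<Longrightarrow> x i > 1" and "N > 0"
    and S: "(\<Sum>i=1..N. ln (x i)) \<le> real N * c" and "c < 1"
    and kc: "k < real N * (c - 1 - ln c)"
  shows "DR_regular {1<..} pareto_density r k \<gamma> \<delta> N x"
proof -
  define t where "t = (\<Sum>i=1..N. ln (x i)) / real N"
  have "(\<Sum>i=1..N. ln (x i)) > 0"
    using x \<open>N > 0\<close> by (intro sum_pos) (auto intro!: ln_gt_zero)
  then have t: "t > 0" "t \<le> c" "t < 1"
    using \<open>N > 0\<close> S \<open>c < 1\<close> by (auto simp: t_def field_simps intro: le_less_trans)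
  define d where "d \<theta> = real N * (\<theta> * t - 1 - ln (\<theta> * t))" for \<theta>
  define K where "K = {\<theta>\<in>{1<..}. d \<theta> \<le> k}"
  \<comment> \<open>Half of the linear term absorbs the logarithm, leaving
    \<open>\<theta> * t / 2 - 1 \<le> k / N\<close> on \<open>K\<close>; solving for
    \<open>\<theta>\<close> gives \<open>B\<close>.\<close>
  define B where "B = 2 * (1 + k / real N) / t"
  have d1: "d 1 > k"
  proof -
    have "real N * (c - 1 - ln c) \<le> d 1"
      unfolding d_def using minus_ln_antimono[of t c] t \<open>c < 1\<close> by (intro mult_left_mono) auto
    with kc show ?thesis by simp
  qed
  \<comment> \<open>Continuity includes the endpoint 1, which is not a parameter, so that closedness
    can be checked on \<open>{1..B}\<close>.\<close>
  have cont: "continuous_on {1..} d"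
    unfolding d_def using t by (intro continuous_intros) auto
  have "\<theta> \<le> B" if "\<theta> > 1" "d \<theta> \<le> k" for \<theta>
  proof -
    have "ln (\<theta> * t / 2) \<le> \<theta> * t / 2 - 1"
      using that t by (intro ln_le_minus_one) auto
    moreover have "ln (\<theta> * t / 2) = ln (\<theta> * t) - ln 2"
      using that t by (simp add: ln_div)
    moreover have "ln 2 \<le> (1::real)"
      using ln_le_minus_one[of 2] by simp
    ultimately have "\<theta> * t / 2 - 1 \<le> \<theta> * t - 1 - ln (\<theta> * t)"
      by simp
    also have "\<dots> \<le> k / real N"
      using that \<open>N > 0\<close> by (simp add: d_def field_simps)
    finally show ?thesis
      using t by (simp add: B_def field_simps)
  qed
  \<comment> \<open>Adjoining the endpoint 1 adds nothing, since \<open>d 1 > k\<close>.\<close>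
  then have "K = {\<theta>\<in>{1..B}. d \<theta> \<le> k}"
    using d1 by (auto simp: K_def less_le)
  moreover have "closed {\<theta>\<in>{1..B}. d \<theta> \<le> k}"
    by (rule continuous_on_closed_Collect_le)
      (auto intro!: continuous_on_subset[OF cont] continuous_intros)
  ultimately have "compact K"
    using compact_Int_closed[of "{1..B}" K] by (simp add: Int_absorb1 subset_iff)
  show ?thesis
  proof (rule DR_regularI[OF assms(1-3), where d = d and K = K and \<rho> = \<rho> and \<theta>' = "1 / t"])
    fix \<theta> :: real assume "\<theta> \<in> {1<..}"
    then show "divergence {1<..} pareto_density N x \<theta> = ereal (d \<theta>)"
      using divergence_pareto[OF x \<open>N > 0\<close>] t by (simp add: t_def d_def)
    show "0 \<le> d \<theta>"
      using ln_le_minus_one[of "\<theta> * t"] \<open>\<theta> \<in> _\<close> t by (auto simp: d_def)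
  next
    show "continuous_on K \<rho>" "continuous_on K d"
      by (auto simp: K_def intro!: continuous_on_subset[OF \<rho>(3)] continuous_on_subset[OF cont])
  qed (use r \<rho> t \<open>compact K\<close> in \<open>auto simp: K_def d_def\<close>)
qed

section \<open>Regularity on events of probability tending to 1\<close>

theorem theorem6:
  fixes M :: "'a measure" and Q :: "real \<Rightarrow> 'a measure" and X :: "nat \<Rightarrow> 'a \<Rightarrow> real"
    and k \<beta> :: real and \<gamma> :: ereal
  assumes "iid_model M {1<..} pareto_density Q X"
    and "k > 0" and "1 \<le> \<gamma>" and "\<beta> \<ge> 1"
  shows "DR_regularizable {1<..} pareto_density Q X (CL \<beta>) k \<gamma>"
  unfolding DR_regularizable_def
\<comment> \<open>The exponent \<open>1/2\<close> is one choice among many: it matters only that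
  \<open>N powr \<delta>\<close> eventually exceeds \<open>k\<close>.\<close>
proof (intro exI[of _ "1/2"] conjI ballI)
  interpret iid_model M "{1<..}" pareto_density Q X by fact
  let ?r = "\<lambda>\<theta>. CL \<beta> (distr (Q \<theta>) borel (X 0))"
  let ?reg = "\<lambda>N \<omega>. DR_regular {1<..} pareto_density ?r k \<gamma> (1/2) N (\<lambda>i. X i \<omega>)"
  fix P assume "P \<in> Q ` {1<..}"
  then obtain \<theta> where P: "P = Q \<theta>" and \<theta>: "\<theta> > 1" by auto
  interpret prob_space P using prob_space_Q \<theta> P by simp
  have X: "distributed P lborel (X i) (\<lambda>x. ennreal (pareto_density \<theta> x))" for i
    using distributed_X[of \<theta> i] \<theta> P by simp
  have ind: "indep_vars (\<lambda>_. borel) X UNIV"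
    using indep_X[of \<theta>] \<theta> P by simp
  have [measurable]: "X i \<in> borel_measurable P" for i
    using distributed_measurable[OF X[of i]] by simp
  \<comment> \<open>Half the distance from the mean \<open>1 / \<theta>\<close> to 1, so that
    \<open>c\<close> is the midpoint between them.\<close>
  define \<epsilon> where "\<epsilon> = (1 - 1 / \<theta>) / 2"
  define c where "c = 1 / \<theta> + \<epsilon>"
  have "\<epsilon> > 0" using \<theta> by (simp add: \<epsilon>_def)
  have c: "0 < c" "c < 1" using \<theta> by (auto simp: c_def \<epsilon>_def field_simps)
  \<comment> \<open>Strict because \<open>ln c = c - 1\<close> only at \<open>c = 1\<close>; this is
    the linear growth rate of the lower bound on the divergence at 1.\<close>
  have gap: "c - 1 - ln c > 0"
    using ln_le_minus_one[of c] ln_eq_minus_one[of c] c by (auto simp: less_le)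
  let ?large = "\<lambda>N. N > 0 \<and> k < real N powr (1/2) \<and> k < real N * (c - 1 - ln c)"
  have "filterlim (\<lambda>N. real N powr (1/2)) at_top sequentially"
    by real_asymp
  moreover have "filterlim (\<lambda>N. real N * (c - 1 - ln c)) at_top sequentially"
    using gap by (intro filterlim_at_top_mult_tendsto_pos[OF tendsto_const] filterlim_real_sequentially)
  ultimately have large: "eventually ?large sequentially"
    by (intro eventually_conj eventually_gt_at_top) (auto simp: filterlim_at_top_dense)
  \<comment> \<open>The size conditions on \<open>N\<close> are part of the event, so
    \<open>A N\<close> is empty for small \<open>N\<close> and implies regularity for every
    \<open>N\<close>.\<close>
  define A where "A N = {\<omega>\<in>space P. ?large N \<and> (\<forall>i\<in>{1..N}. X i \<omega> > 1) \<and>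
    (\<Sum>i=1..N. ln (X i \<omega>)) \<le> real N * c}" for N
  show "with_prob_tending_to_1 P ?reg"
    unfolding with_prob_tending_to_1_def
  proof (intro exI[of _ A] conjI allI ballI)
    fix N
    show "A N \<in> events" unfolding A_def by measurable
    fix \<omega> assume "\<omega> \<in> A N"
    \<comment> \<open>The bound \<open>\<theta>\<close> here ranges over all competing parameters,
      not only the true one.\<close>
    moreover have "?r \<theta> = ereal (\<beta> powr (1 - \<theta>) / \<theta>)" if "\<theta> > 1" for \<theta>
      using that \<open>\<beta> \<ge> 1\<close> distributed_X[of \<theta> 0] by (intro CL_pareto) auto
    moreover have "\<beta> powr (1 - \<theta>) / \<theta> \<le> 1" if "\<theta> > 1" for \<theta>
      using that \<open>\<beta> \<ge> 1\<close> powr_mono[of "1 - \<theta>" 0 \<beta>] by simp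
    moreover have "continuous_on {1<..} (\<lambda>\<theta>. \<beta> powr (1 - \<theta>) / \<theta>)"
      using \<open>\<beta> \<ge> 1\<close> by (auto intro!: continuous_intros)
    ultimately show "?reg N \<omega>"
      using assms(2-4) c unfolding A_def
      by (intro DR_regular_pareto[where c = c and \<rho> = "\<lambda>\<theta>. \<beta> powr (1 - \<theta>) / \<theta>"]) auto
  next
    have lower: "1 - 1 / (\<theta>\<^sup>2 * \<epsilon>\<^sup>2 * real N) \<le> prob (A N)" if "?large N" for N
    proof -
      \<comment> \<open>Once \<open>N\<close> is large, the support condition holds almost surely,
        so only the deviation of the log-sum costs probability.\<close>
      have "AE \<omega> in P. \<forall>i\<in>{1..N}. X i \<omega> > 1"
        using pareto_AE_gt_1[OF X] \<theta> by (intro AE_finite_allI) auto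
      then have "prob (A N) = \<P>(\<omega> in P. \<not> (\<Sum>i=1..N. ln (X i \<omega>)) > real N * c)"
        using that unfolding A_def
        by (intro measure_eq_AE) (auto elim!: eventually_mono simp: not_less)
      also have "\<dots> = 1 - \<P>(\<omega> in P. (\<Sum>i=1..N. ln (X i \<omega>)) > real N * c)"
        by (rule prob_neg) auto
      finally show ?thesis
        using pareto_ln_sum_deviation[OF X ind _ \<open>\<epsilon> > 0\<close>, of N] \<theta> that by (simp add: c_def)
    qed
    show "(\<lambda>N. prob (A N)) \<longlonglongrightarrow> 1"
    proof (rule tendsto_sandwich)
      show "\<forall>\<^sub>F N in sequentially. 1 - 1 / (\<theta>\<^sup>2 * \<epsilon>\<^sup>2 * real N) \<le> prob (A N)"
        using large lower by (rule eventually_mono)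
      have "(\<lambda>N. 1 - (1 / (\<theta>\<^sup>2 * \<epsilon>\<^sup>2)) * (1 / real N)) \<longlonglongrightarrow> 1 - (1 / (\<theta>\<^sup>2 * \<epsilon>\<^sup>2)) * 0"
        by (intro tendsto_intros lim_1_over_n)
      then show "(\<lambda>N. 1 - 1 / (\<theta>\<^sup>2 * \<epsilon>\<^sup>2 * real N)) \<longlonglongrightarrow> 1"
        by simp
    qed (auto intro!: always_eventually prob_le_1)
  qed
qed simp

end
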